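(* Let $D$ be a diagram with nonempty columns $c_1<c_2<\cdots<c_n$, and for $i\in[n]$ let $(r_i,c_i)$ be the topmost cell in column $c_i$ of $D$. Then \[\mathrm{mc}(D)=\sum_{i=1}^n\bigl[r_i-h(D,c_i)\bigr].\]
   Context: A diagram is a finite subset $D\subset\mathbb{Z}_{>0}\times\mathbb{Z}_{>0}$; an element $(r,c)\in D$ is a cell in row $r$, column $c$. For $r\in\mathbb{Z}_{>0}$, the Kohnert move at row $r$: if row $r$ of $D$ is empty, $\mathcal{K}(D,r)=D$; otherwise let $(r,c)$ be the cell of row $r$ with largest column index; if some $r'<r$ has $(r',c)\notin D$, let $r'$ be the largest such and $\mathcal{K}(D,r)=(D\setminus\{(r,c)\})\cup\{(r',c)\}$; otherwise $\mathcal{K}(D,r)=D$. The move is nontrivial if $\mathcal{K}(D,r)\ne D$. $\mathrm{KD}(D)$ is the set of diagrams obtainable from $D$ by finite (possibly empty) sequences of Kohnert moves; $\mathrm{Min}(D)=\{\tilde D\in\mathrm{KD}(D):\mathcal{K}(\tilde D,r)=\tilde D\ \forall r\}$. $\mathrm{mc}(D)$ is the minimum, over all $\tilde D\in\mathrm{Min}(D)$ and all sequences $(r_1,\dots,r_m)$ such that with $D_0=D$, $D_i=\mathcal{K}(D_{i-1},r_i)$ each move is nontrivial and $D_m=\tilde D$, of the length $m$. For a nonempty column $c$ of $D$: let $m_c$ be the number of cells in column $c$, $M$ the maximum number of cells in a column strictly to the right of $c$ (with $M=0$ if there is none), and $r$ the row of the topmost cell of column $c$; define $h(D,c)=r$ if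 $M\ge r$, $h(D,c)=m_c$ if $m_c\ge M$, and $h(D,c)=M$ if $r>M>m_c$. *)

theory Defs
  imports Main
begin

type_synonym cell = "nat \<times> nat"

text \<open>A cell is a pair (row, column); rows are numbered from bottom to top, starting at 1,
  so the topmost cell of a column is the one with the largest row index.\<close>

definition diagram :: "cell set \<Rightarrow> bool" where
  "diagram D \<longleftrightarrow> finite D \<and> D \<subseteq> {0<..} \<times> {0<..}"

definition row_cols :: "cell set \<Rightarrow> nat \<Rightarrow> nat set" where
  "row_cols D r = {c. (r, c) \<in> D}"

definition column_rows :: "cell set \<Rightarrow> nat \<Rightarrow> nat set" where
  "column_rows D c = {r. (r, c) \<in> D}"

definition nonempty_columns :: "cell set \<Rightarrow> nat set" where
  "nonempty_columns D = {c. column_rows D c \<noteq> {}}"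

definition kohnert_move :: "cell set \<Rightarrow> nat \<Rightarrow> cell set" where
  "kohnert_move D r =
    (if row_cols D r = {} then D
     else let c = Max (row_cols D r); S = {r'. 0 < r' \<and> r' < r \<and> (r', c) \<notin> D}
          in if S = {} then D else insert (Max S, c) (D - {(r, c)}))"

inductive_set KD :: "cell set \<Rightarrow> cell set set" for D :: "cell set" where
  KD_refl: "D \<in> KD D"
| KD_step: "E \<in> KD D \<Longrightarrow> 0 < r \<Longrightarrow> kohnert_move E r \<in> KD D"

definition minimal_KD :: "cell set \<Rightarrow> cell set set" where
  "minimal_KD D = {E \<in> KD D. \<forall>r>0. kohnert_move E r = E}"

fun nontrivial_moves :: "cell set \<Rightarrow> nat list \<Rightarrow> cell set \<Rightarrow> bool" where
  "nontrivial_moves D [] E \<longleftrightarrow> E = D"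
| "nontrivial_moves D (r # rs) E \<longleftrightarrow>
     0 < r \<and> kohnert_move D r \<noteq> D \<and> nontrivial_moves (kohnert_move D r) rs E"

definition mc :: "cell set \<Rightarrow> nat" where
  "mc D = (LEAST m. \<exists>E \<in> minimal_KD D. \<exists>rs. nontrivial_moves D rs E \<and> length rs = m)"

definition top_row :: "cell set \<Rightarrow> nat \<Rightarrow> nat" where
  "top_row D c = Max (column_rows D c)"

definition right_max :: "cell set \<Rightarrow> nat \<Rightarrow> nat" where
  "right_max D c = Max (insert 0 ((\<lambda>c'. card (column_rows D c')) ` {c' \<in> nonempty_columns D. c < c'}))"

text \<open>The three cases cover everything, and where the first two overlap they agree,
  since a column with topmost row \<open>r\<close> has at most \<open>r\<close> cells.\<close>

definition h :: "cell set \<Rightarrow> nat \<Rightarrow> nat" where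
  "h D c =
    (let m = card (column_rows D c); M = right_max D c; r = top_row D c
     in if r \<le> M then r else if M \<le> m then m else M)"

text \<open>The minimum in \<^const>\<open>mc\<close> is taken over a nonempty set: each nontrivial move lowers
  the sum of the row indices.\<close>

lemma kohnert_move_decreases:
  assumes "finite D" "kohnert_move D r \<noteq> D"
  shows "finite (kohnert_move D r)" "sum fst (kohnert_move D r) < sum fst D"
proof -
  define c where "c = Max (row_cols D r)"
  define S where "S = {r'. 0 < r' \<and> r' < r \<and> (r', c) \<notin> D}"
  have ne: "row_cols D r \<noteq> {}" "S \<noteq> {}"
    and eq: "kohnert_move D r = insert (Max S, c) (D - {(r, c)})"
    using assms(2) by (auto simp: kohnert_move_def Let_def c_def S_def split: if_splits)
  have "row_cols D r \<subseteq> snd ` D"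
    by (force simp: row_cols_def)
  then have "c \<in> row_cols D r"
    unfolding c_def using Max_in ne(1) assms(1) by (meson finite_imageI finite_subset)
  then have rc: "(r, c) \<in> D"
    by (simp add: row_cols_def)
  have "finite S" by (simp add: S_def)
  then have "Max S \<in> S" using Max_in ne(2) by blast
  then have S: "Max S < r" "(Max S, c) \<notin> D" by (auto simp: S_def)
  show "finite (kohnert_move D r)" using eq assms(1) by simp
  have "sum fst (kohnert_move D r) = Max S + sum fst (D - {(r, c)})"
    using S assms(1) by (simp add: eq)
  also have "\<dots> < r + sum fst (D - {(r, c)})" using S by simp
  also have "\<dots> = sum fst D" using sum.remove[OF assms(1) rc, of fst] by simp
  finally show "sum fst (kohnert_move D r) < sum fst D" .
qed

lemma KD_trans: "F \<in> KD E \<Longrightarrow> E \<in> KD D \<Longrightarrow> F \<in> KD D"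
  by (induction rule: KD.induct) (auto intro: KD.intros)

lemma mc_wellfounded:
  assumes "finite D"
  shows "\<exists>E \<in> minimal_KD D. \<exists>rs. nontrivial_moves D rs E"
  using assms
proof (induction "sum fst D" arbitrary: D rule: less_induct)
  case less
  show ?case
  proof (cases "\<forall>r>0. kohnert_move D r = D")
    case True
    then have "D \<in> minimal_KD D" by (simp add: minimal_KD_def KD_refl)
    moreover have "nontrivial_moves D [] D" by simp
    ultimately show ?thesis by blast
  next
    case False
    then obtain r where r: "0 < r" "kohnert_move D r \<noteq> D" by blast
    obtain E rs where E: "E \<in> minimal_KD (kohnert_move D r)"
      "nontrivial_moves (kohnert_move D r) rs E"
      using less.hyps kohnert_move_decreases[OF less.prems r(2)] by blast
    have "E \<in> minimal_KD D"
      using E(1) KD_trans[OF _ KD_step[OF KD_refl r(1)]] by (auto simp: minimal_KD_def)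
    moreover have "nontrivial_moves D (r # rs) E" using r E(2) by simp
    ultimately show ?thesis by blast
  qed
qed

end

theory Submission
  imports Defs
begin

text \<open>Moves preserve the number of cells of each column, hence also the largest number \<open>b(c)\<close>
  of cells in a column weakly to the right of \<open>c\<close> (\<open>weak_right_max\<close>). The term \<open>r - h(D, c)\<close> is
  the excess of the topmost row \<open>r\<close> of column \<open>c\<close> over \<open>b(c)\<close>, and zero if \<open>r\<close> is at most
  \<open>b(c)\<close>. A move of the topmost cell of a column lowers the top by exactly one, because the rows
  it jumps over are occupied; any other move leaves all tops unchanged. So the total excess drops
  by at most one in each move.
  If it is positive, then the topmost cell of the rightmost column with positive excess is the
  last cell of its row and has a gap below it, and moving it lowers the total excess.
  If it is zero, then for each column \<open>c\<close> a column with \<open>b(c)\<close> cells weakly to the right of \<open>c\<close>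
  has no gaps and is at least as high as \<open>c\<close>, so that no cell of column \<open>c\<close> can move.\<close>

definition gaps_below :: "nat set \<Rightarrow> nat \<Rightarrow> nat set" where
  "gaps_below A r = {0<..<r} - A"

definition lower :: "nat set \<Rightarrow> nat \<Rightarrow> nat set" where
  "lower A r = insert (Max (gaps_below A r)) (A - {r})"

lemma Max_gaps_below_in:
  assumes "gaps_below A r \<noteq> {}"
  shows "Max (gaps_below A r) \<in> gaps_below A r"
  using assms by (intro Max_in) (simp_all add: gaps_below_def)

lemma in_if_above_Max_gaps_below:
  assumes "Max (gaps_below A r) < t" "t < r"
  shows "t \<in> A"
proof (rule ccontr)
  assume "t \<notin> A"
  with assms have "t \<in> gaps_below A r"
    by (simp add: gaps_below_def)
  then have "t \<le> Max (gaps_below A r)"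
    by (intro Max_ge) (simp_all add: gaps_below_def)
  with assms(1) show False by simp
qed

lemma gaps_below_nonempty_if_card_less:
  assumes "finite A" "r \<in> A" "card A < r"
  shows "gaps_below A r \<noteq> {}"
proof
  assume "gaps_below A r = {}"
  then have "insert r {0<..<r} \<subseteq> A"
    using assms(2) by (auto simp: gaps_below_def)
  moreover have "insert r {0<..<r} = {0<..r}"
    using assms(3) by auto
  ultimately have "{0<..r} \<subseteq> A" by simp
  from card_mono[OF assms(1) this] assms(3) show False by simp
qed

lemma card_lower:
  assumes "finite A" "r \<in> A" "gaps_below A r \<noteq> {}"
  shows "card (lower A r) = card A"
proof -
  have "Max (gaps_below A r) \<notin> A"
    using Max_gaps_below_in[OF assms(3)] by (simp add: gaps_below_def)
  then show ?thesis
    using assms(1,2) card.remove[of A r] by (simp add: lower_def)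
qed

lemma Max_lower_Max:
  assumes "finite A" "gaps_below A (Max A) \<noteq> {}"
  shows "Max (lower A (Max A)) = Max A - 1"
proof (rule Max_eqI)
  have gap_less: "Max (gaps_below A (Max A)) < Max A"
    using Max_gaps_below_in[OF assms(2)] by (simp add: gaps_below_def)
  show "finite (lower A (Max A))"
    using assms(1) by (simp add: lower_def)
  show "Max A - 1 \<in> lower A (Max A)"
  proof (cases "Max (gaps_below A (Max A)) = Max A - 1")
    case False
    with gap_less have "Max A - 1 \<in> A" "Max A - 1 \<noteq> Max A"
      using in_if_above_Max_gaps_below[of A "Max A" "Max A - 1"] by auto
    then show ?thesis by (simp add: lower_def)
  qed (simp add: lower_def)
  show "a \<le> Max A - 1" if "a \<in> lower A (Max A)" for a
  proof -
    have "a \<noteq> Max A" "a \<le> Max A"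
      using that gap_less Max_ge[OF assms(1)] by (auto simp: lower_def)
    then show ?thesis by simp
  qed
qed

lemma Max_lower_not_Max:
  assumes "finite A" "r \<in> A" "gaps_below A r \<noteq> {}" "r \<noteq> Max A"
  shows "Max (lower A r) = Max A"
proof (rule Max_eqI)
  show "finite (lower A r)"
    using assms(1) by (simp add: lower_def)
  have "A \<noteq> {}" using assms(2) by auto
  then show "Max A \<in> lower A r"
    using Max_in[OF assms(1)] assms(4) by (simp add: lower_def)
  have "Max (gaps_below A r) < r"
    using Max_gaps_below_in[OF assms(3)] by (simp add: gaps_below_def)
  also have "r \<le> Max A"
    using Max_ge[OF assms(1,2)] .
  finally show "a \<le> Max A" if "a \<in> lower A r" for a
    using that Max_ge[OF assms(1)] by (auto simp: lower_def)
qed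

lemma finite_if_diagram: "diagram D \<Longrightarrow> finite D"
  by (simp add: diagram_def)

lemma finite_row_cols: "finite D \<Longrightarrow> finite (row_cols D r)"
  by (rule finite_subset[of _ "snd ` D"]) (force simp: row_cols_def)+

lemma finite_column_rows: "finite D \<Longrightarrow> finite (column_rows D c)"
  by (rule finite_subset[of _ "fst ` D"]) (force simp: column_rows_def)+

lemma nonempty_columns_eq_image: "nonempty_columns D = snd ` D"
  by (force simp: nonempty_columns_def column_rows_def)

lemma finite_nonempty_columns: "finite D \<Longrightarrow> finite (nonempty_columns D)"
  by (simp add: nonempty_columns_eq_image)

lemma nonempty_columnsI: "(r, c) \<in> D \<Longrightarrow> c \<in> nonempty_columns D"
  by (force simp: nonempty_columns_eq_image)

lemma top_row_in: "finite D \<Longrightarrow> c \<in> nonempty_columns D \<Longrightarrow> top_row D c \<in> column_rows D c"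
  unfolding top_row_def by (rule Max_in[OF finite_column_rows]) (simp_all add: nonempty_columns_def)

lemma le_top_row: "finite D \<Longrightarrow> (r, c) \<in> D \<Longrightarrow> r \<le> top_row D c"
  unfolding top_row_def by (rule Max_ge[OF finite_column_rows]) (simp_all add: column_rows_def)

lemma column_rows_subset: "diagram D \<Longrightarrow> column_rows D c \<subseteq> {1..top_row D c}"
  using le_top_row[OF finite_if_diagram] by (fastforce simp: column_rows_def diagram_def)

lemma card_column_rows_le_top_row: "diagram D \<Longrightarrow> card (column_rows D c) \<le> top_row D c"
  using card_mono[OF _ column_rows_subset, of D c] by simp

lemma column_rows_eq_if_top_row_le_card:
  assumes "diagram D" "top_row D c \<le> card (column_rows D c)"
  shows "column_rows D c = {1..card (column_rows D c)}"
proof -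
  have "card (column_rows D c) = top_row D c"
    using assms card_column_rows_le_top_row by (simp add: le_antisym)
  then show ?thesis
    using card_subset_eq[OF _ column_rows_subset[OF assms(1)], of c] by simp
qed

definition rightmost_cell :: "cell set \<Rightarrow> nat \<Rightarrow> nat \<Rightarrow> bool" where
  "rightmost_cell D r c \<longleftrightarrow> (r, c) \<in> D \<and> (\<forall>c'. (r, c') \<in> D \<longrightarrow> c' \<le> c)"

lemma rightmost_cell_iff_Max:
  assumes "finite D" "row_cols D r \<noteq> {}"
  shows "rightmost_cell D r c \<longleftrightarrow> Max (row_cols D r) = c"
  using Max_eq_iff[OF finite_row_cols[OF assms(1)] assms(2), of c]
  by (auto simp: rightmost_cell_def row_cols_def)

lemma kohnert_move_rightmost_cell:
  assumes "finite D" "rightmost_cell D r c"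
  shows "kohnert_move D r =
    (if gaps_below (column_rows D c) r = {} then D
     else insert (Max (gaps_below (column_rows D c) r), c) (D - {(r, c)}))"
proof -
  have "row_cols D r \<noteq> {}"
    using assms(2) by (auto simp: rightmost_cell_def row_cols_def)
  moreover from this have "Max (row_cols D r) = c"
    using assms rightmost_cell_iff_Max by blast
  moreover have "{s. 0 < s \<and> s < r \<and> (s, c) \<notin> D} = gaps_below (column_rows D c) r"
    by (auto simp: gaps_below_def column_rows_def)
  ultimately show ?thesis
    by (simp only: kohnert_move_def Let_def if_False)
qed

lemma kohnert_move_eq_iff:
  assumes "finite D" "rightmost_cell D r c"
  shows "kohnert_move D r = D \<longleftrightarrow> gaps_below (column_rows D c) r = {}"
  using Max_gaps_below_in[of "column_rows D c" r]
  by (auto simp: kohnert_move_rightmost_cell[OF assms] gaps_below_def column_rows_def)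

lemma kohnert_move_neqE:
  assumes "finite D" "kohnert_move D r \<noteq> D"
  obtains c where "rightmost_cell D r c" "gaps_below (column_rows D c) r \<noteq> {}"
proof -
  have "row_cols D r \<noteq> {}"
    using assms(2) by (auto simp: kohnert_move_def)
  then have "rightmost_cell D r (Max (row_cols D r))"
    by (simp add: rightmost_cell_iff_Max[OF assms(1)])
  with that assms show thesis
    by (simp add: kohnert_move_eq_iff)
qed

lemma column_rows_kohnert_move:
  assumes "finite D" "rightmost_cell D r c" "gaps_below (column_rows D c) r \<noteq> {}"
  shows "column_rows (kohnert_move D r) = (column_rows D)(c := lower (column_rows D c) r)"
  using assms(3)
  by (auto simp: kohnert_move_rightmost_cell[OF assms(1,2)] column_rows_def lower_def fun_eq_iff)

lemma diagram_kohnert_move: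
  assumes "diagram D"
  shows "diagram (kohnert_move D r)"
proof (cases "kohnert_move D r = D")
  case False
  then obtain c where "rightmost_cell D r c" and gap: "gaps_below (column_rows D c) r \<noteq> {}"
    using kohnert_move_neqE[OF finite_if_diagram[OF assms]] by blast
  then show ?thesis
    using assms Max_gaps_below_in[OF gap]
    by (auto simp: kohnert_move_rightmost_cell diagram_def rightmost_cell_def gaps_below_def)
qed (simp add: assms)

lemma card_column_rows_kohnert_move:
  assumes "finite D"
  shows "card (column_rows (kohnert_move D r) c) = card (column_rows D c)"
proof (cases "kohnert_move D r = D")
  case False
  then obtain c' where move: "rightmost_cell D r c'" "gaps_below (column_rows D c') r \<noteq> {}"
    using kohnert_move_neqE[OF assms] by blast
  then have "card (lower (column_rows D c') r) = card (column_rows D c')"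
    by (intro card_lower finite_column_rows assms) (auto simp: rightmost_cell_def column_rows_def)
  then show ?thesis
    by (simp add: column_rows_kohnert_move[OF assms move])
qed simp

lemma nonempty_columns_eq_card:
  "finite D \<Longrightarrow> nonempty_columns D = {c. card (column_rows D c) \<noteq> 0}"
  by (simp add: nonempty_columns_def finite_column_rows)

lemma finite_kohnert_move: "finite D \<Longrightarrow> finite (kohnert_move D r)"
  by (simp add: kohnert_move_def Let_def)

lemma nonempty_columns_kohnert_move:
  "finite D \<Longrightarrow> nonempty_columns (kohnert_move D r) = nonempty_columns D"
  by (simp add: nonempty_columns_eq_card card_column_rows_kohnert_move finite_kohnert_move)

lemma top_row_kohnert_move:
  assumes "finite D" "rightmost_cell D r c" "gaps_below (column_rows D c) r \<noteq> {}"
  shows "top_row (kohnert_move D r) c' =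
    (if c' = c \<and> r = top_row D c then top_row D c - 1 else top_row D c')"
proof -
  have "r \<in> column_rows D c"
    using assms(2) by (simp add: rightmost_cell_def column_rows_def)
  then show ?thesis
    using assms(3) finite_column_rows[OF assms(1), of c]
      Max_lower_Max[of "column_rows D c"] Max_lower_not_Max[of "column_rows D c" r]
    by (auto simp: top_row_def column_rows_kohnert_move[OF assms])
qed

definition weak_right_max :: "cell set \<Rightarrow> nat \<Rightarrow> nat" where
  "weak_right_max D c = Max ((\<lambda>c'. card (column_rows D c')) ` {c' \<in> nonempty_columns D. c \<le> c'})"

lemma card_le_weak_right_max:
  assumes "finite D" "c' \<in> nonempty_columns D" "c \<le> c'"
  shows "card (column_rows D c') \<le> weak_right_max D c"
  unfolding weak_right_max_def using assms finite_nonempty_columns by (intro Max_ge) auto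

lemma weak_right_max_attained:
  assumes "finite D" "c \<in> nonempty_columns D"
  obtains c' where "c' \<in> nonempty_columns D" "c \<le> c'"
    "weak_right_max D c = card (column_rows D c')"
proof -
  have "weak_right_max D c \<in> (\<lambda>c'. card (column_rows D c')) ` {c' \<in> nonempty_columns D. c \<le> c'}"
    unfolding weak_right_max_def using assms finite_nonempty_columns by (intro Max_in) auto
  with that show thesis by blast
qed

lemma weak_right_max_antimono:
  assumes "finite D" "c' \<in> nonempty_columns D" "c \<le> c'"
  shows "weak_right_max D c' \<le> weak_right_max D c"
  unfolding weak_right_max_def using assms finite_nonempty_columns by (intro Max_mono) auto

lemma weak_right_max_eq_max:
  assumes "finite D" "c \<in> nonempty_columns D"
  shows "weak_right_max D c = max (card (column_rows D c)) (right_max D c)"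
proof -
  define right_cards where
    "right_cards = (\<lambda>c'. card (column_rows D c')) ` {c' \<in> nonempty_columns D. c < c'}"
  have "{c' \<in> nonempty_columns D. c \<le> c'} = insert c {c' \<in> nonempty_columns D. c < c'}"
    using assms(2) by auto
  then have "weak_right_max D c = Max (insert (card (column_rows D c)) right_cards)"
    by (simp add: weak_right_max_def right_cards_def)
  moreover have "right_max D c = Max (insert 0 right_cards)"
    by (simp add: right_max_def right_cards_def)
  moreover have "finite right_cards"
    using finite_nonempty_columns[OF assms(1)] by (simp add: right_cards_def)
  ultimately show ?thesis
    by (cases "right_cards = {}") simp_all
qed

lemma h_eq_min:
  assumes "diagram D" "c \<in> nonempty_columns D"
  shows "h D c = min (top_row D c) (weak_right_max D c)"
  using card_column_rows_le_top_row[OF assms(1), of c]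
  by (auto simp: h_def Let_def weak_right_max_eq_max[OF finite_if_diagram[OF assms(1)] assms(2)])

lemma weak_right_max_kohnert_move:
  "finite D \<Longrightarrow> weak_right_max (kohnert_move D r) c = weak_right_max D c"
  by (simp add: weak_right_max_def card_column_rows_kohnert_move nonempty_columns_kohnert_move)

definition column_excess :: "cell set \<Rightarrow> nat \<Rightarrow> nat" where
  "column_excess D c = top_row D c - weak_right_max D c"

definition excess :: "cell set \<Rightarrow> nat" where
  "excess D = (\<Sum>c \<in> nonempty_columns D. column_excess D c)"

lemma int_column_excess:
  assumes "diagram D" "c \<in> nonempty_columns D"
  shows "int (column_excess D c) = int (top_row D c) - int (h D c)"
  by (simp add: column_excess_def h_eq_min[OF assms])

lemma excess_eq_0_iff:
  "finite D \<Longrightarrow> excess D = 0 \<longleftrightarrow> (\<forall>c \<in> nonempty_columns D. top_row D c \<le> weak_right_max D c)"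
  by (simp add: excess_def column_excess_def finite_nonempty_columns)

lemma excess_kohnert_move:
  assumes "finite D" "rightmost_cell D r c" "gaps_below (column_rows D c) r \<noteq> {}"
  shows "excess D =
    excess (kohnert_move D r) + (if r = top_row D c \<and> 0 < column_excess D c then 1 else 0)"
proof -
  let ?drop = "if r = top_row D c \<and> 0 < column_excess D c then 1 else 0 :: nat"
  have "c \<in> nonempty_columns D"
    using assms(2) by (auto simp: rightmost_cell_def intro: nonempty_columnsI)
  have "column_excess D c' =
      column_excess (kohnert_move D r) c' + (if c' = c then ?drop else 0)" for c'
    by (auto simp: column_excess_def top_row_kohnert_move[OF assms]
        weak_right_max_kohnert_move[OF assms(1)])
  then have "excess D = (\<Sum>c' \<in> nonempty_columns D.
      column_excess (kohnert_move D r) c' + (if c' = c then ?drop else 0))"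
    unfolding excess_def by (rule sum.cong[OF refl])
  also have "\<dots> = excess (kohnert_move D r) + ?drop"
    using finite_nonempty_columns[OF assms(1)] \<open>c \<in> nonempty_columns D\<close>
    by (simp add: sum.distrib excess_def nonempty_columns_kohnert_move[OF assms(1)])
  finally show ?thesis .
qed

lemma excess_le_Suc_excess_kohnert_move:
  assumes "finite D" "kohnert_move D r \<noteq> D"
  shows "excess D \<le> Suc (excess (kohnert_move D r))"
proof -
  obtain c where "rightmost_cell D r c" "gaps_below (column_rows D c) r \<noteq> {}"
    using kohnert_move_neqE[OF assms] .
  from excess_kohnert_move[OF assms(1) this] show ?thesis by simp
qed

lemma rightmost_top_cell_with_excess:
  assumes "finite D" "0 < excess D"
  obtains c where "c \<in> nonempty_columns D" "weak_right_max D c < top_row D c"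
    "rightmost_cell D (top_row D c) c"
proof -
  let ?high_columns = "{c \<in> nonempty_columns D. weak_right_max D c < top_row D c}"
  have "finite ?high_columns"
    using finite_nonempty_columns[OF assms(1)] by simp
  have "?high_columns \<noteq> {}"
    using assms(2) excess_eq_0_iff[OF assms(1)] by (auto simp: not_le)
  define c where "c = Max ?high_columns"
  then have nonempty: "c \<in> nonempty_columns D" and high: "weak_right_max D c < top_row D c"
    using Max_in[OF \<open>finite ?high_columns\<close> \<open>?high_columns \<noteq> {}\<close>] by auto
  have "c' \<le> c" if cell: "(top_row D c, c') \<in> D" for c'
  proof (rule ccontr)
    assume "\<not> c' \<le> c"
    have c'_nonempty: "c' \<in> nonempty_columns D"
      using nonempty_columnsI[OF cell] .
    have "weak_right_max D c' \<le> weak_right_max D c"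
      using weak_right_max_antimono[OF assms(1) c'_nonempty] \<open>\<not> c' \<le> c\<close> by simp
    also have "\<dots> < top_row D c" by (rule high)
    also have "\<dots> \<le> top_row D c'" by (rule le_top_row[OF assms(1) cell])
    finally have "c' \<le> c"
      using Max_ge[OF \<open>finite ?high_columns\<close>] c'_nonempty by (simp add: c_def)
    with \<open>\<not> c' \<le> c\<close> show False by simp
  qed
  then have "rightmost_cell D (top_row D c) c"
    using top_row_in[OF assms(1) nonempty] by (simp add: rightmost_cell_def column_rows_def)
  with that nonempty high show thesis by blast
qed

lemma excess_decreasing_move:
  assumes "finite D" "0 < excess D"
  obtains r where "0 < r" "kohnert_move D r \<noteq> D" "excess D = Suc (excess (kohnert_move D r))"
proof -
  obtain c where nonempty: "c \<in> nonempty_columns D"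
    and high: "weak_right_max D c < top_row D c"
    and rightmost: "rightmost_cell D (top_row D c) c"
    using rightmost_top_cell_with_excess[OF assms] .
  have "card (column_rows D c) < top_row D c"
    using card_le_weak_right_max[OF assms(1) nonempty order_refl] high by simp
  then have gap: "gaps_below (column_rows D c) (top_row D c) \<noteq> {}"
    by (intro gaps_below_nonempty_if_card_less finite_column_rows top_row_in assms(1) nonempty)
  show thesis
  proof (rule that)
    show "0 < top_row D c" using high by simp
    show "kohnert_move D (top_row D c) \<noteq> D"
      using gap by (simp add: kohnert_move_eq_iff[OF assms(1) rightmost])
    show "excess D = Suc (excess (kohnert_move D (top_row D c)))"
      using excess_kohnert_move[OF assms(1) rightmost gap] high by (simp add: column_excess_def)
  qed
qed

lemma full_column_weakly_right:
  assumes "diagram D" "excess D = 0" "c \<in> nonempty_columns D"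
  obtains c' where "c \<le> c'" "{1..top_row D c} \<subseteq> column_rows D c'"
proof -
  note finite = finite_if_diagram[OF assms(1)]
  have top_le: "top_row D c'' \<le> weak_right_max D c''" if "c'' \<in> nonempty_columns D" for c''
    using that assms(2) excess_eq_0_iff[OF finite] by blast
  obtain c' where nonempty: "c' \<in> nonempty_columns D" and right: "c \<le> c'"
    and attained: "weak_right_max D c = card (column_rows D c')"
    using weak_right_max_attained[OF finite assms(3)] .
  have "top_row D c' \<le> card (column_rows D c')"
    using top_le[OF nonempty] weak_right_max_antimono[OF finite nonempty right] attained by simp
  then have "column_rows D c' = {1..card (column_rows D c')}"
    by (rule column_rows_eq_if_top_row_le_card[OF assms(1)])
  also have "{1..top_row D c} \<subseteq> \<dots>"
    using top_le[OF assms(3)] attained by simp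
  finally show thesis using that right by blast
qed

lemma kohnert_move_eq_if_excess_0:
  assumes "diagram D" "excess D = 0"
  shows "kohnert_move D r = D"
proof (rule ccontr)
  note finite = finite_if_diagram[OF assms(1)]
  assume "kohnert_move D r \<noteq> D"
  then obtain c where rightmost: "rightmost_cell D r c"
    and gap: "gaps_below (column_rows D c) r \<noteq> {}"
    using kohnert_move_neqE[OF finite] by blast
  then have cell: "(r, c) \<in> D" by (simp add: rightmost_cell_def)
  then have r_bounds: "1 \<le> r" "r \<le> top_row D c"
    using le_top_row[OF finite] assms(1) by (auto simp: diagram_def)
  obtain c' where right: "c \<le> c'" and full: "{1..top_row D c} \<subseteq> column_rows D c'"
    using full_column_weakly_right[OF assms nonempty_columnsI[OF cell]] .
  then have "(r, c') \<in> D"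
    using r_bounds by (auto simp: column_rows_def)
  then have "c' = c"
    using rightmost right by (simp add: rightmost_cell_def le_antisym)
  then have "{0<..<r} \<subseteq> column_rows D c"
    using full r_bounds(2) by (auto simp: subset_iff)
  with gap show False by (simp add: gaps_below_def)
qed

lemma excess_0_iff_kohnert_move_eq:
  assumes "diagram D"
  shows "excess D = 0 \<longleftrightarrow> (\<forall>r>0. kohnert_move D r = D)"
proof
  show "excess D = 0" if fixed: "\<forall>r>0. kohnert_move D r = D"
  proof (rule ccontr)
    assume "excess D \<noteq> 0"
    then have "0 < excess D" by simp
    then obtain r where "0 < r" "kohnert_move D r \<noteq> D"
      using excess_decreasing_move[OF finite_if_diagram[OF assms]] by blast
    with fixed show False by blast
  qed
qed (simp add: kohnert_move_eq_if_excess_0[OF assms])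

lemma diagram_KD: "E \<in> KD D \<Longrightarrow> diagram D \<Longrightarrow> diagram E"
  by (induction rule: KD.induct) (auto intro: diagram_kohnert_move)

lemma minimal_KD_eq_excess_0:
  assumes "diagram D"
  shows "minimal_KD D = {E \<in> KD D. excess E = 0}"
  using excess_0_iff_kohnert_move_eq[OF diagram_KD[OF _ assms]] by (auto simp: minimal_KD_def)

lemma KD_if_nontrivial_moves: "nontrivial_moves D rs E \<Longrightarrow> E \<in> KD D"
proof (induction rs arbitrary: D)
  case Nil
  then show ?case by (simp add: KD_refl)
next
  case (Cons r rs)
  then have "kohnert_move D r \<in> KD D" "E \<in> KD (kohnert_move D r)"
    by (auto intro: KD.intros)
  then show ?case using KD_trans by blast
qed

lemma excess_le_excess_plus_length:
  assumes "finite D" "nontrivial_moves D rs E"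
  shows "excess D \<le> excess E + length rs"
  using assms
proof (induction rs arbitrary: D)
  case (Cons r rs)
  then have "excess (kohnert_move D r) \<le> excess E + length rs"
    by (simp add: finite_kohnert_move)
  moreover have "excess D \<le> Suc (excess (kohnert_move D r))"
    using Cons.prems by (simp add: excess_le_Suc_excess_kohnert_move)
  ultimately show ?case by simp
qed simp

lemma nontrivial_moves_to_excess_0:
  assumes "finite D"
  shows "\<exists>E rs. nontrivial_moves D rs E \<and> length rs = excess D \<and> excess E = 0"
  using assms
proof (induction "excess D" arbitrary: D)
  case 0
  then have "nontrivial_moves D [] D \<and> length [] = excess D \<and> excess D = 0" by simp
  then show ?case by blast
next
  case (Suc k)
  then obtain r where move: "0 < r" "kohnert_move D r \<noteq> D"
    "excess D = Suc (excess (kohnert_move D r))"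
    using excess_decreasing_move[of D] by auto
  with Suc.hyps(2) have "k = excess (kohnert_move D r)" by simp
  then obtain E rs where rest: "nontrivial_moves (kohnert_move D r) rs E"
    "length rs = excess (kohnert_move D r)" "excess E = 0"
    using Suc.hyps(1) finite_kohnert_move[OF Suc.prems] by blast
  with move have "nontrivial_moves D (r # rs) E \<and> length (r # rs) = excess D \<and> excess E = 0" by simp
  then show ?case by blast
qed

lemma mc_eq_excess:
  assumes "diagram D"
  shows "mc D = excess D"
  unfolding mc_def
proof (rule Least_equality)
  show "\<exists>E \<in> minimal_KD D. \<exists>rs. nontrivial_moves D rs E \<and> length rs = excess D"
    using nontrivial_moves_to_excess_0[OF finite_if_diagram[OF assms]] KD_if_nontrivial_moves
    by (auto simp: minimal_KD_eq_excess_0[OF assms])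
  show "excess D \<le> m"
    if "\<exists>E \<in> minimal_KD D. \<exists>rs. nontrivial_moves D rs E \<and> length rs = m" for m
    using that excess_le_excess_plus_length[OF finite_if_diagram[OF assms]]
    by (fastforce simp: minimal_KD_eq_excess_0[OF assms])
qed

theorem theorem4p1:
  fixes D :: "cell set" and n :: nat and c r :: "nat \<Rightarrow> nat"
  assumes "diagram D"
    and "strict_mono_on {1..n} c"
    and "c ` {1..n} = nonempty_columns D"
    and "\<And>i. i \<in> {1..n} \<Longrightarrow> r i = top_row D (c i)"
  shows "int (mc D) = (\<Sum>i = 1..n. int (r i) - int (h D (c i)))"
proof -
  have bij: "bij_betw c {1..n} (nonempty_columns D)"
    using assms(2,3) by (simp add: bij_betw_def strict_mono_on_imp_inj_on)
  have "int (mc D) = (\<Sum>c \<in> nonempty_columns D. int (column_excess D c))"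
    by (simp add: mc_eq_excess[OF assms(1)] excess_def)
  also have "\<dots> = (\<Sum>c \<in> nonempty_columns D. int (top_row D c) - int (h D c))"
    by (intro sum.cong refl int_column_excess assms(1))
  also have "\<dots> = (\<Sum>i = 1..n. int (top_row D (c i)) - int (h D (c i)))"
    by (rule sum.reindex_bij_betw[OF bij, symmetric])
  also have "\<dots> = (\<Sum>i = 1..n. int (r i) - int (h D (c i)))"
    by (intro sum.cong refl) (simp add: assms(4))
  finally show ?thesis .
qed

end
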